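(* Let $g\geq 2$ and let $X$ be a $g$-dimensional complex abelian variety with period matrix $\Pi=(\tau\ \ I_g)$, where $\tau=(\tau_{ij})\in M_g(\mathbb{C})$ satisfies $\det(\operatorname{Im}\tau)\neq 0$. Suppose that $$\mathfrak{d}=[\mathbb{Q}(\{\tau_{ij}\}):\mathbb{Q}]=3.$$ Then $X$ is isogenous to $E^g$ for an elliptic curve $E$ without complex multiplication, and the Picard number of $X$ is $\rho(X)=\frac{g(g+1)}{2}$.
   Context: A complex torus of dimension $g$ with period matrix $\Pi=(\tau\ \ I_g)$ is $X=\mathbb{C}^g/\Lambda$, where $\Lambda\subset\mathbb{C}^g$ is the lattice generated by the $2g$ columns of $\Pi$; every complex torus admits such a period matrix with $\det(\operatorname{Im}\tau)\neq0$. The Picard number $\rho(X)$ is the rank of the Néron–Severi group $\mathrm{NS}(X)$. An elliptic curve $E$ has complex multiplication if $\operatorname{End}(E)\otimes\mathbb{Q}$ is an imaginary quadratic field. *)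

theory Defs
  imports "HOL-Analysis.Analysis"
begin

definition period_lattice :: "complex^'n^'n \<Rightarrow> (complex^'n) set" where
  "period_lattice \<tau> =
     {\<tau> *v (\<chi> i. of_int (m$i)) + (\<chi> i. of_int (k$i)) | m k :: int^'n. True}"

definition Im_mat :: "complex^'n^'n \<Rightarrow> real^'n^'n" where
  "Im_mat \<tau> = (\<chi> i j. Im (\<tau>$i$j))"

definition hermitian_mat :: "complex^'n^'n \<Rightarrow> bool" where
  "hermitian_mat H \<longleftrightarrow> (\<forall>i j. H$j$i = cnj (H$i$j))"

definition herm_form :: "complex^'n^'n \<Rightarrow> complex^'n \<Rightarrow> complex^'n \<Rightarrow> complex" where
  "herm_form H v w = (\<Sum>i\<in>UNIV. \<Sum>j\<in>UNIV. v$i * H$i$j * cnj (w$j))"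

text \<open>NS(X) = Hermitian forms H whose imaginary part is integral on the lattice
  (Appell-Humbert).\<close>
definition NS :: "(complex^'n) set \<Rightarrow> (complex^'n^'n) set" where
  "NS \<Lambda> = {H. hermitian_mat H \<and>
              (\<forall>v\<in>\<Lambda>. \<forall>w\<in>\<Lambda>. Im (herm_form H v w) \<in> \<int>)}"

definition positive_definite_herm :: "complex^'n^'n \<Rightarrow> bool" where
  "positive_definite_herm H \<longleftrightarrow> (\<forall>v. v \<noteq> 0 \<longrightarrow> Re (herm_form H v v) > 0)"

definition is_abelian_variety :: "(complex^'n) set \<Rightarrow> bool" where
  "is_abelian_variety \<Lambda> \<longleftrightarrow> (\<exists>H\<in>NS \<Lambda>. positive_definite_herm H)"

definition int_independent :: "(complex^'n^'n) set \<Rightarrow> bool" where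
  "int_independent S \<longleftrightarrow>
     (\<forall>c :: complex^'n^'n \<Rightarrow> int.
        (\<Sum>H\<in>S. real_of_int (c H) *\<^sub>R H) = 0 \<longrightarrow> (\<forall>H\<in>S. c H = 0))"

definition picard_number :: "(complex^'n) set \<Rightarrow> nat" where
  "picard_number \<Lambda> =
     (GREATEST k. \<exists>S. S \<subseteq> NS \<Lambda> \<and> finite S \<and> card S = k \<and> int_independent S)"

text \<open>An isogeny C^g/L1 -> C^g/L2 is induced by an invertible C-linear map A with A L1 \<subseteq> L2
  (a surjective homomorphism with finite kernel).\<close>
definition isogenous :: "(complex^'n) set \<Rightarrow> (complex^'n) set \<Rightarrow> bool" where
  "isogenous L1 L2 \<longleftrightarrow> (\<exists>A :: complex^'n^'n. invertible A \<and> (\<forall>v\<in>L1. A *v v \<in> L2))"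

definition ell_lattice :: "complex \<Rightarrow> complex set" where
  "ell_lattice t = {of_int a + of_int b * t | a b :: int. True}"

definition power_lattice :: "complex \<Rightarrow> (complex^'n) set" where
  "power_lattice t = {v. \<forall>i. v$i \<in> ell_lattice t}"

text \<open>End(E) \<otimes> Q, realised inside C as {alpha : n alpha L \<subseteq> L for some n > 0}.\<close>
definition End_Q :: "complex \<Rightarrow> complex set" where
  "End_Q t = {\<alpha>. \<exists>n::nat. n > 0 \<and> (\<forall>z\<in>ell_lattice t. of_nat n * \<alpha> * z \<in> ell_lattice t)}"

definition imag_quadratic_field :: "complex set \<Rightarrow> bool" where
  "imag_quadratic_field K \<longleftrightarrow>
     (\<exists>d::int. d < 0 \<and> K = {of_rat a + of_rat b * csqrt (of_int d) | a b. True})"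

definition has_CM :: "complex \<Rightarrow> bool" where
  "has_CM t \<longleftrightarrow> imag_quadratic_field (End_Q t)"

definition is_subfield :: "complex set \<Rightarrow> bool" where
  "is_subfield F \<longleftrightarrow> 0 \<in> F \<and> 1 \<in> F \<and>
     (\<forall>x\<in>F. \<forall>y\<in>F. x + y \<in> F \<and> x - y \<in> F \<and> x * y \<in> F) \<and>
     (\<forall>x\<in>F. x \<noteq> 0 \<longrightarrow> inverse x \<in> F)"

definition gen_field :: "complex set \<Rightarrow> complex set" where
  "gen_field S = \<Inter>{F. is_subfield F \<and> S \<subseteq> F}"

definition Q_degree_eq :: "complex set \<Rightarrow> nat \<Rightarrow> bool" where
  "Q_degree_eq K d \<longleftrightarrow>
     (\<exists>b :: nat \<Rightarrow> complex. (\<forall>i<d. b i \<in> K) \<and>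
        (\<forall>q :: nat \<Rightarrow> rat. (\<Sum>i<d. of_rat (q i) * b i) = 0 \<longrightarrow> (\<forall>i<d. q i = 0)) \<and>
        K = {(\<Sum>i<d. of_rat (q i) * b i) | q :: nat \<Rightarrow> rat. True})"

end

theory Submission
  imports Defs
begin

text \<open>
  Since \<open>Im \<tau>\<close> is invertible, the cubic field \<open>K = \<rat>(\<tau>\<^sub>i\<^sub>j)\<close> is not real, so \<open>K = \<rat>(\<alpha>)\<close> with \<open>\<alpha>\<close> non-real of
  trace zero, and the third root \<open>\<beta> = - 2 Re \<alpha>\<close> is real. The kernel of the period map and its
  two Galois conjugates are Lagrangian for the polarization. Positivity forces the real conjugate to be
  transverse to the other two, i.e. \<open>\<tau> - \<sigma>(\<tau>)\<close> is invertible for the real conjugate \<open>\<sigma>(\<tau>)\<close>. Writing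
  \<open>\<tau> = T\<^sub>0 + \<alpha> T\<^sub>1 + \<alpha>\<^sup>2 T\<^sub>2\<close> with rational \<open>T\<^sub>k\<close>, this and \<open>det (Im \<tau>) \<noteq> 0\<close> say that \<open>T\<^sub>1 - \<xi> T\<^sub>2\<close> is invertible for all three
  roots \<open>\<xi>\<close>, and linear algebra with this rational pencil yields isogenies in both directions between \<open>X\<close> and
  \<open>E\<^sup>g\<close>, where \<open>E = \<complex>/(\<int> + \<int>\<alpha>)\<close>. Because \<open>1, \<alpha>, \<alpha>\<^sup>2\<close> are independent over \<open>\<rat>\<close>, \<open>E\<close> has no complex
  multiplication and \<open>NS(E\<^sup>g)\<close> consists of the symmetric integer matrices divided by \<open>Im \<alpha>\<close>.
\<close>

section \<open>Non-real cubic fields\<close>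

lemma linear_dependence:
  fixes v :: "'a \<Rightarrow> 'b \<Rightarrow> 'c::idom"
  assumes "finite I" "finite S" "card I < card S"
  shows "\<exists>c. (\<exists>s\<in>S. c s \<noteq> 0) \<and> (\<forall>i\<in>I. (\<Sum>s\<in>S. c s * v s i) = 0)"
  using assms
proof (induction I arbitrary: S v rule: finite_induct)
  case empty
  then have "S \<noteq> {}" by auto
  then show ?case by (intro exI[of _ "\<lambda>_. 1"]) auto
next
  case (insert i I)
  show ?case
  proof (cases "\<forall>s\<in>S. v s i = 0")
    case True
    have "card I < card S" using insert by simp
    from insert.IH[OF insert.prems(1) this, of v] True show ?thesis by auto
  next
    case False
    then obtain s0 where s0: "s0 \<in> S" "v s0 i \<noteq> 0" by blast
    define w where "w s j = v s0 i * v s j - v s i * v s0 j" for s j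
    have "card I < card (S - {s0})" using insert s0 by simp
    from insert.IH[OF _ this, of w] insert.prems(1) obtain c where
      c: "\<exists>s\<in>S - {s0}. c s \<noteq> 0" "\<And>j. j \<in> I \<Longrightarrow> (\<Sum>s\<in>S - {s0}. c s * w s j) = 0"
      by auto
    define c' where "c' s = (if s = s0 then - (\<Sum>s\<in>S - {s0}. c s * v s i) else v s0 i * c s)" for s
    have eq: "(\<Sum>s\<in>S. c' s * v s j) = (\<Sum>s\<in>S - {s0}. c s * w s j)" for j
    proof -
      have "(\<Sum>s\<in>S. c' s * v s j) = c' s0 * v s0 j + (\<Sum>s\<in>S - {s0}. c' s * v s j)"
        using insert.prems(1) s0(1) by (simp add: sum.remove)
      also have "(\<Sum>s\<in>S - {s0}. c' s * v s j) = (\<Sum>s\<in>S - {s0}. v s0 i * c s * v s j)"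
        by (intro sum.cong) (auto simp: c'_def)
      finally show ?thesis
        by (simp add: c'_def w_def algebra_simps sum_subtractf sum_distrib_left sum_distrib_right)
    qed
    have "w s i = 0" for s by (simp add: w_def)
    then have "\<forall>j\<in>insert i I. (\<Sum>s\<in>S. c' s * v s j) = 0"
      unfolding eq using c(2) by auto
    moreover have "\<exists>s\<in>S. c' s \<noteq> 0" using c(1) s0 by (auto simp: c'_def)
    ultimately show ?thesis by blast
  qed
qed

lemma rat_dependence:
  fixes b x :: "nat \<Rightarrow> complex"
  assumes "\<And>j. j < n \<Longrightarrow> \<exists>q :: nat \<Rightarrow> rat. x j = (\<Sum>i<d. of_rat (q i) * b i)" and "d < n"
  shows "\<exists>c :: nat \<Rightarrow> rat. (\<exists>j<n. c j \<noteq> 0) \<and> (\<Sum>j<n. of_rat (c j) * x j) = 0"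
proof -
  from assms(1) obtain q :: "nat \<Rightarrow> nat \<Rightarrow> rat"
    where q: "\<And>j. j < n \<Longrightarrow> x j = (\<Sum>i<d. of_rat (q j i) * b i)" by metis
  obtain c where c: "\<exists>j\<in>{..<n}. c j \<noteq> 0" "\<forall>i\<in>{..<d}. (\<Sum>j<n. c j * q j i) = 0"
    using linear_dependence[of "{..<d}" "{..<n}" q] assms(2) by auto
  have "(\<Sum>j<n. of_rat (c j) * x j) = (\<Sum>j<n. \<Sum>i<d. of_rat (c j * q j i) * b i)"
    by (intro sum.cong) (auto simp: q sum_distrib_left of_rat_mult mult.assoc)
  also have "\<dots> = (\<Sum>i<d. of_rat (\<Sum>j<n. c j * q j i) * b i)"
    by (subst sum.swap) (simp add: of_rat_sum sum_distrib_right)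
  also have "\<dots> = 0" using c(2) by simp
  finally show ?thesis using c(1) by auto
qed

lemma is_subfield_gen_field: "is_subfield (gen_field S)"
  unfolding is_subfield_def gen_field_def by blast

lemma gen_field_superset: "S \<subseteq> gen_field S"
  unfolding gen_field_def by blast

lemma complex_of_rat_eq: "(of_rat r :: complex) = of_real (of_rat r)"
  by (cases r) (simp add: of_rat_rat)

lemma Re_of_rat [simp]: "Re (of_rat r) = of_rat r"
  and Im_of_rat [simp]: "Im (of_rat r) = 0"
  and cnj_of_rat [simp]: "cnj (of_rat r) = of_rat r"
  by (simp_all add: complex_of_rat_eq)

lemma rat_lincomb_nonreal_eq_0:
  assumes "Im \<theta> \<noteq> 0" "of_rat a + of_rat b * \<theta> = 0"
  shows "a = 0 \<and> b = 0"
proof -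
  have "Im (of_rat a + of_rat b * \<theta>) = of_rat b * Im \<theta>" by simp
  then have "b = 0" using assms by simp
  then show ?thesis using assms(2) by simp
qed

lemma cubic_field_nonreal_basis:
  assumes K: "is_subfield K" "Q_degree_eq K 3" and \<theta>: "\<theta> \<in> K" "Im \<theta> \<noteq> 0"
  shows cubic_field_nonreal_indep:
      "\<And>a b c. of_rat a + of_rat b * \<theta> + of_rat c * \<theta>\<^sup>2 = 0 \<Longrightarrow> a = 0 \<and> b = 0 \<and> c = 0"
    and cubic_field_nonreal_span:
      "\<And>x. x \<in> K \<Longrightarrow> \<exists>a b c. x = of_rat a + of_rat b * \<theta> + of_rat c * \<theta>\<^sup>2"
proof -
  from K(2) obtain B :: "nat \<Rightarrow> complex" where
    Bi: "\<And>q :: nat \<Rightarrow> rat. (\<Sum>i<3. of_rat (q i) * B i) = 0 \<Longrightarrow> \<forall>i<3. q i = 0"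
    and BK: "\<And>i. i < 3 \<Longrightarrow> B i \<in> K"
    and KB: "K = {(\<Sum>i<3. of_rat (q i) * B i) | q :: nat \<Rightarrow> rat. True}"
    unfolding Q_degree_eq_def by blast
  have K1: "1 \<in> K" and Kmult: "\<And>x y. x \<in> K \<Longrightarrow> y \<in> K \<Longrightarrow> x * y \<in> K"
    using K(1) unfolding is_subfield_def by auto
  have dep: "\<exists>a b c d. (a \<noteq> 0 \<or> b \<noteq> 0 \<or> c \<noteq> 0 \<or> d \<noteq> 0) \<and>
      of_rat a * w + of_rat b * x + of_rat c * y + of_rat d * z = 0"
    if "w \<in> K" "x \<in> K" "y \<in> K" "z \<in> K" for w x y z
  proof -
    define f where "f j = (if j = 0 then w else if j = 1 then x else if j = 2 then y else z)" for j :: nat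
    have "f j \<in> K" for j using that by (simp add: f_def)
    then have "\<exists>c :: nat \<Rightarrow> rat. (\<exists>j<4. c j \<noteq> 0) \<and> (\<Sum>j<4. of_rat (c j) * f j) = 0"
      by (intro rat_dependence[where d = 3 and b = B]) (auto simp: KB)
    then obtain c :: "nat \<Rightarrow> rat" and j where c: "j < 4" "c j \<noteq> 0" "(\<Sum>j<4. of_rat (c j) * f j) = 0"
      by blast
    have "j = 0 \<or> j = 1 \<or> j = 2 \<or> j = 3" using c(1) by linarith
    then show ?thesis using c(2,3)
      by (intro exI[of _ "c 0"] exI[of _ "c 1"] exI[of _ "c 2"] exI[of _ "c 3"])
        (auto simp: f_def eval_nat_numeral)
  qed
  show indep: "a = 0 \<and> b = 0 \<and> c = 0" if eq: "of_rat a + of_rat b * \<theta> + of_rat c * \<theta>\<^sup>2 = 0" for a b c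
  proof (cases "c = 0")
    case True
    then show ?thesis using rat_lincomb_nonreal_eq_0[OF \<theta>(2), of a b] eq by simp
  next
    case False
    define u w where "u = - b / c" and "w = - a / c"
    have sq: "\<theta>\<^sup>2 = of_rat u * \<theta> + of_rat w"
      using eq False unfolding u_def w_def
      by (simp add: of_rat_divide of_rat_minus field_simps) (metis add_eq_0_iff add.commute add.left_commute)
    have span2: "\<exists>a b. x = of_rat a + of_rat b * \<theta>" if x: "x \<in> K" for x
    proof -
      obtain c0 c1 c2 c3 where nz: "c0 \<noteq> 0 \<or> c1 \<noteq> 0 \<or> c2 \<noteq> 0 \<or> c3 \<noteq> 0"
        and z: "of_rat c0 * 1 + of_rat c1 * \<theta> + of_rat c2 * x + of_rat c3 * (\<theta> * x) = 0"
        using dep[OF K1 \<theta>(1) x Kmult[OF \<theta>(1) x]] by blast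
      have z': "of_rat c0 + of_rat c1 * \<theta> + (of_rat c2 + of_rat c3 * \<theta>) * x = 0"
        using z by (simp add: algebra_simps)
      have n1: "of_rat c2 + of_rat c3 * \<theta> \<noteq> 0"
      proof
        assume 0: "of_rat c2 + of_rat c3 * \<theta> = 0"
        then have "c2 = 0 \<and> c3 = 0" by (rule rat_lincomb_nonreal_eq_0[OF \<theta>(2)])
        moreover have "c0 = 0 \<and> c1 = 0"
          using z' 0 by (intro rat_lincomb_nonreal_eq_0[OF \<theta>(2)]) simp
        ultimately show False using nz by blast
      qed
      have n2: "of_rat (c2 + c3 * u) + of_rat (- c3) * \<theta> \<noteq> 0"
        using rat_lincomb_nonreal_eq_0[OF \<theta>(2), of "c2 + c3 * u" "- c3"] n1 by auto
      define n where "n = c2\<^sup>2 + c2 * c3 * u - c3\<^sup>2 * w"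
      have nn: "of_rat n = (of_rat c2 + of_rat c3 * \<theta>) * (of_rat (c2 + c3 * u) + of_rat (- c3) * \<theta>)"
        using sq unfolding n_def of_rat_add of_rat_mult of_rat_diff of_rat_minus of_rat_power by algebra
      have n0: "of_rat n \<noteq> (0::complex)" using nn n1 n2 by simp
      have "of_rat n * x = - ((of_rat c0 + of_rat c1 * \<theta>) * (of_rat (c2 + c3 * u) + of_rat (- c3) * \<theta>))"
        unfolding nn using z' by algebra
      also have "\<dots> = of_rat (- c0 * (c2 + c3 * u) + c1 * c3 * w) + of_rat (c0 * c3 - c1 * c2) * \<theta>"
        using sq unfolding of_rat_add of_rat_mult of_rat_diff of_rat_minus by algebra
      finally have "x = of_rat ((- c0 * (c2 + c3 * u) + c1 * c3 * w) / n) + of_rat ((c0 * c3 - c1 * c2) / n) * \<theta>"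
        using n0 by (simp add: of_rat_divide field_simps)
      then show ?thesis by blast
    qed
    define e where "e i = (if i = 0 then 1 else \<theta>)" for i :: nat
    have "\<exists>q :: nat \<Rightarrow> rat. B j = (\<Sum>i<2. of_rat (q i) * e i)" if j: "j < 3" for j
    proof -
      obtain a b where "B j = of_rat a + of_rat b * \<theta>" using span2[OF BK[OF j]] by blast
      then show ?thesis
        by (intro exI[of _ "\<lambda>i. if i = 0 then a else b"]) (simp add: e_def eval_nat_numeral)
    qed
    from rat_dependence[where n = 3 and d = 2 and x = B and b = e, OF this] Bi show ?thesis by auto
  qed
  show "\<exists>a b c. x = of_rat a + of_rat b * \<theta> + of_rat c * \<theta>\<^sup>2" if x: "x \<in> K" for x
  proof -
    obtain c0 c1 c2 c3 where nz: "c0 \<noteq> 0 \<or> c1 \<noteq> 0 \<or> c2 \<noteq> 0 \<or> c3 \<noteq> 0"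
      and z: "of_rat c0 * 1 + of_rat c1 * \<theta> + of_rat c2 * (\<theta> * \<theta>) + of_rat c3 * x = 0"
      using dep[OF K1 \<theta>(1) Kmult[OF \<theta>(1) \<theta>(1)] x] by blast
    have c3: "c3 \<noteq> 0"
      using indep[of c0 c1 c2] nz z by (auto simp: power2_eq_square)
    have "x * of_rat c3 = - (of_rat c0 + of_rat c1 * \<theta> + of_rat c2 * \<theta>\<^sup>2)"
      using z by algebra
    then have "x = - (of_rat c0 + of_rat c1 * \<theta> + of_rat c2 * \<theta>\<^sup>2) / of_rat c3"
      using c3 by (simp add: eq_divide_eq)
    then have "x = of_rat (- c0 / c3) + of_rat (- c1 / c3) * \<theta> + of_rat (- c2 / c3) * \<theta>\<^sup>2"
      by (simp add: of_rat_divide of_rat_minus add_divide_distrib diff_divide_distrib)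
    then show ?thesis by blast
  qed
qed

locale trace_zero_cubic =
  fixes \<alpha> :: complex and p q :: rat
  assumes Im_pos: "Im \<alpha> > 0"
    and cube: "\<alpha> ^ 3 = of_rat p * \<alpha> + of_rat q"
    and indep: "of_rat a + of_rat b * \<alpha> + of_rat c * \<alpha>\<^sup>2 = 0 \<Longrightarrow> a = 0 \<and> b = 0 \<and> c = 0"

lemma cubic_field_trace_zero_generator:
  assumes K: "is_subfield K" "Q_degree_eq K 3" and "\<eta> \<in> K" "Im \<eta> \<noteq> 0"
  obtains \<alpha> p q where "trace_zero_cubic \<alpha> p q"
    "\<And>x. x \<in> K \<Longrightarrow> \<exists>a b c. x = of_rat a + of_rat b * \<alpha> + of_rat c * \<alpha>\<^sup>2"
proof -
  have "- \<eta> \<in> K" using assms unfolding is_subfield_def by (metis diff_0)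
  then obtain \<theta> where \<theta>: "\<theta> \<in> K" "Im \<theta> > 0"
    using assms(3,4) by (metis linorder_neqE_linordered_idom neg_0_less_iff_less uminus_complex.sel(2))
  then have \<theta>0: "Im \<theta> \<noteq> 0" by simp
  note indep = cubic_field_nonreal_indep[OF K \<theta>(1) \<theta>0]
  note span = cubic_field_nonreal_span[OF K \<theta>(1) \<theta>0]
  have "\<theta> * (\<theta> * \<theta>) \<in> K" using K(1) \<theta>(1) unfolding is_subfield_def by blast
  from span[OF this] obtain a b c where c3: "\<theta> ^ 3 = of_rat a + of_rat b * \<theta> + of_rat c * \<theta>\<^sup>2"
    by (auto simp: power3_eq_cube mult.assoc)
  define h where "h = c / 3"
  define \<alpha> where "\<alpha> = \<theta> - of_rat h"
  have ch: "of_rat c = 3 * (of_rat h :: complex)"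
    unfolding h_def by (simp add: of_rat_divide)
  have \<theta>\<alpha>: "\<theta> = \<alpha> + of_rat h" by (simp add: \<alpha>_def)
  define p q where "p = b + 3 * h\<^sup>2" and "q = a + b * h + 2 * h ^ 3"
  have "trace_zero_cubic \<alpha> p q"
  proof
    show "Im \<alpha> > 0" using \<theta> by (simp add: \<alpha>_def)
    have "(\<alpha> + of_rat h) ^ 3 = of_rat a + of_rat b * (\<alpha> + of_rat h) + 3 * of_rat h * (\<alpha> + of_rat h)\<^sup>2"
      using c3 unfolding ch \<theta>\<alpha> .
    then show "\<alpha> ^ 3 = of_rat p * \<alpha> + of_rat q"
      unfolding p_def q_def of_rat_add of_rat_mult of_rat_power of_rat_numeral_eq by algebra
    fix x y z
    assume "of_rat x + of_rat y * \<alpha> + of_rat z * \<alpha>\<^sup>2 = 0"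
    then have "of_rat (x - y * h + z * h\<^sup>2) + of_rat (y - 2 * z * h) * \<theta> + of_rat z * \<theta>\<^sup>2 = 0"
      unfolding \<alpha>_def of_rat_add of_rat_mult of_rat_diff of_rat_power of_rat_numeral_eq by algebra
    from indep[OF this] show "x = 0 \<and> y = 0 \<and> z = 0" by auto
  qed
  moreover have "\<exists>a b c. x = of_rat a + of_rat b * \<alpha> + of_rat c * \<alpha>\<^sup>2" if x: "x \<in> K" for x
  proof -
    obtain u v w where "x = of_rat u + of_rat v * \<theta> + of_rat w * \<theta>\<^sup>2" using span[OF x] by blast
    then have "x = of_rat (u + v * h + w * h\<^sup>2) + of_rat (v + 2 * w * h) * \<alpha> + of_rat w * \<alpha>\<^sup>2"
      unfolding \<theta>\<alpha> of_rat_add of_rat_mult of_rat_power of_rat_numeral_eq by algebra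
    then show ?thesis by blast
  qed
  ultimately show ?thesis using that by blast
qed

context trace_zero_cubic
begin

definition \<beta> :: real where "\<beta> = - 2 * Re \<alpha>"

lemma alpha_ne_cnj: "\<alpha> \<noteq> cnj \<alpha>"
  using Im_pos by (auto simp: complex_eq_iff)

lemma alpha_nonreal: "\<alpha> \<noteq> of_real x"
  using Im_pos by auto

lemma of_real_beta: "of_real \<beta> = - (\<alpha> + cnj \<alpha>)"
  by (simp add: \<beta>_def complex_eq_iff)

lemma cnj_cube: "cnj \<alpha> ^ 3 = of_rat p * cnj \<alpha> + of_rat q"
  using arg_cong[OF cube, of cnj] by simp

lemma root_sum: "\<alpha>\<^sup>2 + \<alpha> * cnj \<alpha> + (cnj \<alpha>)\<^sup>2 = of_rat p"
proof -
  have "(\<alpha> - cnj \<alpha>) * (\<alpha>\<^sup>2 + \<alpha> * cnj \<alpha> + (cnj \<alpha>)\<^sup>2 - of_rat p) = 0"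
    using cube cnj_cube by algebra
  then show ?thesis using alpha_ne_cnj by simp
qed

lemma beta_cube: "complex_of_real \<beta> ^ 3 = of_rat p * of_real \<beta> + of_rat q"
proof -
  have "(- (x + y)) ^ 3 = (x\<^sup>2 + x * y + y\<^sup>2) * - (x + y) + (x ^ 3 - (x\<^sup>2 + x * y + y\<^sup>2) * x)" for x y :: complex
    by algebra
  from this[of \<alpha> "cnj \<alpha>"] show ?thesis
    unfolding of_real_beta root_sum cube by simp
qed

lemma beta_not_rat: "\<beta> \<noteq> of_rat r"
proof
  assume "\<beta> = of_rat r"
  then have r: "complex_of_real \<beta> = of_rat r" by (simp add: complex_of_rat_eq)
  have "(\<alpha> - of_real \<beta>) * (\<alpha>\<^sup>2 + of_rat r * \<alpha> + (of_rat r)\<^sup>2 - of_rat p) = 0"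
    using cube beta_cube unfolding r by algebra
  then have "of_rat (r\<^sup>2 - p) + of_rat r * \<alpha> + of_rat 1 * \<alpha>\<^sup>2 = 0"
    using alpha_nonreal[of \<beta>] unfolding mult_eq_0_iff
    by (simp add: of_rat_diff of_rat_power algebra_simps)
  from indep[OF this] show False by simp
qed

definition conj_rel :: "complex \<Rightarrow> complex \<Rightarrow> bool" where
  "conj_rel x y \<longleftrightarrow> (\<exists>a b c. x = of_rat a + of_rat b * \<alpha> + of_rat c * \<alpha>\<^sup>2 \<and>
     y = of_rat a + of_rat b * of_real \<beta> + of_rat c * (of_real \<beta>)\<^sup>2)"

lemma conj_relI:
  "conj_rel (of_rat a + of_rat b * \<alpha> + of_rat c * \<alpha>\<^sup>2)
     (of_rat a + of_rat b * of_real \<beta> + of_rat c * (of_real \<beta>)\<^sup>2)"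
  unfolding conj_rel_def by blast

lemma conj_rel_0: "conj_rel 0 y \<Longrightarrow> y = 0"
  unfolding conj_rel_def using indep by (metis add_0 mult_zero_left of_rat_0)

lemma conj_rel_of_rat: "conj_rel (of_rat a) (of_rat a)"
  using conj_relI[of a 0 0] by simp

lemma conj_rel_of_int: "conj_rel (of_int a) (of_int a)"
  using conj_rel_of_rat[of "of_int a"] by simp

lemma conj_rel_add: assumes "conj_rel x y" "conj_rel x' y'" shows "conj_rel (x + x') (y + y')"
proof -
  from assms obtain a b c a' b' c' where
    "x = of_rat a + of_rat b * \<alpha> + of_rat c * \<alpha>\<^sup>2" "y = of_rat a + of_rat b * of_real \<beta> + of_rat c * (of_real \<beta>)\<^sup>2"
    "x' = of_rat a' + of_rat b' * \<alpha> + of_rat c' * \<alpha>\<^sup>2" "y' = of_rat a' + of_rat b' * of_real \<beta> + of_rat c' * (of_real \<beta>)\<^sup>2"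
    unfolding conj_rel_def by blast
  then show ?thesis using conj_relI[of "a + a'" "b + b'" "c + c'"]
    by (simp add: of_rat_add algebra_simps)
qed

lemma conj_rel_mult: assumes "conj_rel x y" "conj_rel x' y'" shows "conj_rel (x * x') (y * y')"
proof -
  from assms obtain a b c a' b' c' where x:
    "x = of_rat a + of_rat b * \<alpha> + of_rat c * \<alpha>\<^sup>2" "y = of_rat a + of_rat b * of_real \<beta> + of_rat c * (of_real \<beta>)\<^sup>2"
    "x' = of_rat a' + of_rat b' * \<alpha> + of_rat c' * \<alpha>\<^sup>2" "y' = of_rat a' + of_rat b' * of_real \<beta> + of_rat c' * (of_real \<beta>)\<^sup>2"
    unfolding conj_rel_def by blast
  define u v w where "u = a * a' + (b * c' + c * b') * q"
    and "v = a * b' + b * a' + (b * c' + c * b') * p + c * c' * q"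
    and "w = a * c' + b * b' + c * a' + c * c' * p"
  have "x * x' = of_rat u + of_rat v * \<alpha> + of_rat w * \<alpha>\<^sup>2"
    unfolding x u_def v_def w_def of_rat_add of_rat_mult using cube by algebra
  moreover have "y * y' = of_rat u + of_rat v * of_real \<beta> + of_rat w * (of_real \<beta>)\<^sup>2"
    unfolding x u_def v_def w_def of_rat_add of_rat_mult using beta_cube by algebra
  ultimately show ?thesis using conj_relI by simp
qed

lemma conj_rel_diff: assumes "conj_rel x y" "conj_rel x' y'" shows "conj_rel (x - x') (y - y')"
  using conj_rel_add[OF assms(1) conj_rel_mult[OF conj_rel_of_int[of "-1"] assms(2)]] by simp

lemma conj_rel_sum:
  "(\<And>i. i \<in> A \<Longrightarrow> conj_rel (f i) (g i)) \<Longrightarrow> conj_rel (sum f A) (sum g A)"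
  using conj_rel_of_int[of 0]
  by (induction A rule: infinite_finite_induct) (auto intro: conj_rel_add)

end

section \<open>Hermitian forms and the Riemann relation\<close>

definition cnj_vec :: "complex^'n \<Rightarrow> complex^'n" where
  "cnj_vec v = (\<chi> i. cnj (v$i))"

lemma herm_form_add_left: "herm_form H (u + v) w = herm_form H u w + herm_form H v w"
  and herm_form_diff_left: "herm_form H (u - v) w = herm_form H u w - herm_form H v w"
  and herm_form_scale_left: "herm_form H (c *s u) w = c * herm_form H u w"
  and herm_form_add_right: "herm_form H w (u + v) = herm_form H w u + herm_form H w v"
  and herm_form_diff_right: "herm_form H w (u - v) = herm_form H w u - herm_form H w v"
  and herm_form_scale_right: "herm_form H w (c *s u) = cnj c * herm_form H w u"
  by (simp_all add: herm_form_def algebra_simps sum.distrib sum_subtractf sum_distrib_left)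

lemma herm_form_0_left: "herm_form H 0 w = 0"
  and herm_form_0_right: "herm_form H w 0 = 0"
  by (simp_all add: herm_form_def)

lemma herm_form_sum_left: "herm_form H (sum f A) w = (\<Sum>i\<in>A. herm_form H (f i) w)"
  by (induction A rule: infinite_finite_induct) (simp_all add: herm_form_add_left herm_form_0_left)

lemma herm_form_sum_right: "herm_form H w (sum f A) = (\<Sum>i\<in>A. herm_form H w (f i))"
  by (induction A rule: infinite_finite_induct) (simp_all add: herm_form_add_right herm_form_0_right)

lemma herm_form_swap:
  assumes "hermitian_mat H"
  shows "herm_form H v u = cnj (herm_form H u v)"
proof -
  have "cnj (H$i$j) = H$j$i" for i j
    using assms unfolding hermitian_mat_def by metis
  then have "cnj (herm_form H u v) = (\<Sum>i\<in>UNIV. \<Sum>j\<in>UNIV. v$j * H$j$i * cnj (u$i))"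
    by (simp add: herm_form_def mult_ac)
  also have "\<dots> = herm_form H v u"
    unfolding herm_form_def by (rule sum.swap)
  finally show ?thesis by simp
qed

lemma herm_form_expand_left: "herm_form H c u = (\<Sum>k\<in>UNIV. c$k * herm_form H (axis k 1) u)"
proof -
  have "herm_form H c u = herm_form H (\<Sum>k\<in>UNIV. c$k *s axis k 1) u" by (simp add: basis_expansion)
  then show ?thesis by (simp only: herm_form_sum_left herm_form_scale_left)
qed

lemma herm_form_expand_right: "herm_form H u c = (\<Sum>k\<in>UNIV. cnj (c$k) * herm_form H u (axis k 1))"
proof -
  have "herm_form H u c = herm_form H u (\<Sum>k\<in>UNIV. c$k *s axis k 1)" by (simp add: basis_expansion)
  then show ?thesis by (simp only: herm_form_sum_right herm_form_scale_right)
qed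

lemma of_real_Im_herm_form:
  assumes "hermitian_mat H"
  shows "complex_of_real (Im (herm_form H u v)) = (herm_form H u v - herm_form H v u) / (2 * \<i>)"
  unfolding herm_form_swap[OF assms, of u v] by (simp add: complex_eq_iff)

lemma sum_Im_herm_form_right:
  assumes "hermitian_mat H"
  shows "(\<Sum>l\<in>UNIV. c$l * of_real (Im (herm_form H u (axis l 1)))) =
    (herm_form H u (cnj_vec c) - herm_form H c u) / (2 * \<i>)"
  unfolding of_real_Im_herm_form[OF assms] herm_form_expand_right[of H u "cnj_vec c"]
    herm_form_expand_left[of H c u]
  by (simp add: cnj_vec_def sum_subtractf diff_divide_distrib right_diff_distrib
      sum_divide_distrib sum_distrib_left mult_ac)

lemma sum_Im_herm_form_left:
  assumes "hermitian_mat H"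
  shows "(\<Sum>l\<in>UNIV. c$l * of_real (Im (herm_form H (axis l 1) u))) =
    (herm_form H c u - herm_form H u (cnj_vec c)) / (2 * \<i>)"
  unfolding of_real_Im_herm_form[OF assms] herm_form_expand_right[of H u "cnj_vec c"]
    herm_form_expand_left[of H c u]
  by (simp add: cnj_vec_def sum_subtractf diff_divide_distrib right_diff_distrib
      sum_divide_distrib sum_distrib_left mult_ac)

text \<open>The alternating form \<open>Im H\<close>, extended \<open>\<complex>\<close>-bilinearly in the lattice coordinates, evaluated at the
  vectors with lattice coordinates \<open>(e\<^sub>i, -c)\<close> and \<open>(e\<^sub>j, -d)\<close>, where \<open>u\<close> and \<open>v\<close> are the
  lattice vectors \<open>\<tau> e\<^sub>i\<close> and \<open>\<tau> e\<^sub>j\<close>.\<close>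
definition period_form :: "complex^'n^'n \<Rightarrow> complex^'n \<Rightarrow> complex^'n \<Rightarrow> complex^'n \<Rightarrow> complex^'n \<Rightarrow> complex" where
  "period_form H u v c d = of_real (Im (herm_form H u v))
     - (\<Sum>l\<in>UNIV. d$l * of_real (Im (herm_form H u (axis l 1))))
     - (\<Sum>k\<in>UNIV. c$k * of_real (Im (herm_form H (axis k 1) v)))
     + (\<Sum>k\<in>UNIV. c$k * (\<Sum>l\<in>UNIV. d$l * of_real (Im (herm_form H (axis k 1) (axis l 1)))))"

lemma period_form_eq:
  assumes "hermitian_mat H"
  shows "period_form H u v c d =
    (herm_form H (u - c) (v - cnj_vec d) - herm_form H (v - d) (u - cnj_vec c)) / (2 * \<i>)"
proof -
  have "(\<Sum>k\<in>UNIV. c$k * (\<Sum>l\<in>UNIV. d$l * of_real (Im (herm_form H (axis k 1) (axis l 1))))) =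
    (herm_form H c (cnj_vec d) - herm_form H d (cnj_vec c)) / (2 * \<i>)"
    unfolding sum_Im_herm_form_right[OF assms] herm_form_expand_left[of H c] herm_form_expand_right[of H d "cnj_vec c"]
    by (simp add: cnj_vec_def sum_subtractf diff_divide_distrib right_diff_distrib
      sum_divide_distrib sum_distrib_left mult_ac)
  note double = this
  show ?thesis
    unfolding period_form_def double
    unfolding sum_Im_herm_form_right[OF assms] sum_Im_herm_form_left[OF assms]
    unfolding of_real_Im_herm_form[OF assms]
    by (simp add: herm_form_diff_left herm_form_diff_right field_simps)
qed

text \<open>This is the Riemann relation: \<open>(e\<^sub>i, -\<tau> e\<^sub>i)\<close> are the coordinates of \<open>0\<close>.\<close>
lemma period_form_self: "hermitian_mat H \<Longrightarrow> period_form H u v u v = 0"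
  by (simp add: period_form_eq herm_form_0_left)

lemma period_form_real:
  assumes "hermitian_mat H" "cnj_vec c = c" "cnj_vec d = d"
  shows "period_form H u v c d = of_real (Im (herm_form H (u - c) (v - d)))"
  unfolding period_form_eq[OF assms(1)] assms of_real_Im_herm_form[OF assms(1)] ..

lemma column_in_period_lattice: "column i \<tau> \<in> period_lattice \<tau>"
proof -
  have "(\<chi> j. of_int ((axis i 1 :: int^'a) $ j)) = (axis i 1 :: complex^'a)"
    by (simp add: vec_eq_iff axis_def)
  moreover have "\<tau> *v axis i 1 = column i \<tau>"
    by (simp add: matrix_vector_mult_def axis_def column_def vec_eq_iff if_distrib cong: if_cong)
  ultimately have "column i \<tau> = \<tau> *v (\<chi> j. of_int ((axis i 1 :: int^'a) $ j)) + (\<chi> j. of_int ((0 :: int^'a) $ j))"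
    by (simp add: zero_vec_def[symmetric])
  then show ?thesis unfolding period_lattice_def by blast
qed

lemma axis_in_period_lattice: "axis i 1 \<in> period_lattice \<tau>"
proof -
  have "(\<chi> j. of_int ((axis i 1 :: int^'a) $ j)) = (axis i 1 :: complex^'a)"
    "(\<chi> j. of_int ((0 :: int^'a) $ j)) = (0 :: complex^'a)"
    by (simp_all add: vec_eq_iff axis_def)
  then have "axis i 1 = \<tau> *v (\<chi> j. of_int ((0 :: int^'a) $ j)) + (\<chi> j. of_int ((axis i 1 :: int^'a) $ j))"
    by (simp add: zero_vec_def[symmetric])
  then show ?thesis unfolding period_lattice_def by blast
qed

definition of_real_vec :: "real^'n \<Rightarrow> complex^'n" where
  "of_real_vec v = (\<chi> i. of_real (v$i))"

definition of_real_mat :: "real^'n^'m \<Rightarrow> complex^'n^'m" where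
  "of_real_mat A = (\<chi> i j. of_real (A$i$j))"

lemma (in trace_zero_cubic) Im_herm_form_conj_columns:
  assumes H: "H \<in> NS (period_lattice \<tau>)"
    and X: "\<And>i j. conj_rel (\<tau>$i$j) (of_real (X$i$j))"
  shows "Im (herm_form H (column i (\<tau> - of_real_mat X)) (column j (\<tau> - of_real_mat X))) = 0"
proof -
  have herm: "hermitian_mat H" using H by (simp add: NS_def)
  define e where "e k = (axis k 1 :: complex^'a)" for k
  define c where "c k = (column k (of_real_mat X))" for k
  have c_nth: "c k $ l = of_real (X$l$k)" for k l
    by (simp add: c_def column_def of_real_mat_def)
  have c_real: "cnj_vec (c k) = c k" for k
    by (simp add: cnj_vec_def vec_eq_iff c_nth)
  have col: "column k (\<tau> - of_real_mat X) = column k \<tau> - c k" for k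
    by (simp add: c_def column_def vec_eq_iff)
  have int: "conj_rel (of_real (Im (herm_form H u v))) (of_real (Im (herm_form H u v)))"
    if "u \<in> period_lattice \<tau>" "v \<in> period_lattice \<tau>" for u v
  proof -
    have "Im (herm_form H u v) \<in> \<int>" using H that by (simp add: NS_def)
    then show ?thesis by (auto elim!: Ints_cases intro: conj_rel_of_int)
  qed
  have "conj_rel (period_form H (column i \<tau>) (column j \<tau>) (column i \<tau>) (column j \<tau>))
    (period_form H (column i \<tau>) (column j \<tau>) (c i) (c j))"
    unfolding period_form_def
    by (intro conj_rel_add conj_rel_diff conj_rel_sum conj_rel_mult int
        column_in_period_lattice axis_in_period_lattice)
      (simp_all add: c_nth column_def X)
  then have "period_form H (column i \<tau>) (column j \<tau>) (c i) (c j) = 0"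
    unfolding period_form_self[OF herm] by (rule conj_rel_0)
  then show ?thesis
    unfolding period_form_real[OF herm c_real c_real] col by simp
qed

lemma complex_vec_split:
  "m = of_real_vec (\<chi> i. Re (m$i)) + \<i> *s of_real_vec (\<chi> i. Im (m$i))"
  by (simp add: of_real_vec_def vec_eq_iff complex_eq_iff)

lemma Im_mat_ker:
  assumes "det (Im_mat \<tau>) \<noteq> 0" and "Im_mat \<tau> *v x = 0"
  shows "x = 0"
  using assms invertible_det_nz[of "Im_mat \<tau>"] invertible_left_inverse[of "Im_mat \<tau>"]
    matrix_left_invertible_ker[of "Im_mat \<tau>"] by blast

lemma real_translate_ker:
  assumes "det (Im_mat \<tau>) \<noteq> 0" and "(\<tau> - of_real_mat X) *v of_real_vec x = 0"
  shows "x = 0"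
proof (rule Im_mat_ker[OF assms(1)])
  have "Im (((\<tau> - of_real_mat X) *v of_real_vec x) $ i) = (Im_mat \<tau> *v x) $ i" for i
    by (simp add: matrix_vector_mult_def of_real_mat_def of_real_vec_def Im_mat_def)
  then show "Im_mat \<tau> *v x = 0" using assms(2) by (simp add: vec_eq_iff)
qed

text \<open>Positivity makes the kernel \<open>U\<close> of the period map transverse to its real Galois conjugate: both are
  Lagrangian, and a common vector would be isotropic for the Hermitian form.\<close>
lemma (in trace_zero_cubic) conj_translate_ker:
  assumes H: "H \<in> NS (period_lattice \<tau>)" "positive_definite_herm H"
    and det: "det (Im_mat \<tau>) \<noteq> 0"
    and X: "\<And>i j. conj_rel (\<tau>$i$j) (of_real (X$i$j))"
    and m: "(\<tau> - of_real_mat X) *v m = 0"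
  shows "m = 0"
proof -
  define \<Phi> where "\<Phi> = \<tau> - of_real_mat X"
  define x y where "x = (\<chi> i. Re (m$i))" and "y = (\<chi> i. Im (m$i))"
  have split: "m = of_real_vec x + \<i> *s of_real_vec y"
    unfolding x_def y_def by (rule complex_vec_split)
  have iso: "Im (herm_form H (\<Phi> *v of_real_vec u) (\<Phi> *v of_real_vec v)) = 0" for u v
    using Im_herm_form_conj_columns[OF H(1) X] unfolding \<Phi>_def[symmetric]
    unfolding matrix_mult_sum[of \<Phi>] herm_form_sum_left herm_form_sum_right
      herm_form_scale_left herm_form_scale_right
    by (simp add: of_real_vec_def)
  have "\<Phi> *v of_real_vec x + \<i> *s (\<Phi> *v of_real_vec y) = 0"
    using m unfolding \<Phi>_def[symmetric] split by (simp add: matrix_vector_right_distrib vec.scale)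
  then have xy: "\<Phi> *v of_real_vec x = (- \<i>) *s (\<Phi> *v of_real_vec y)"
    by (simp add: eq_neg_iff_add_eq_0 vec_eq_iff)
  have "Re (herm_form H (\<Phi> *v of_real_vec y) (\<Phi> *v of_real_vec y)) = 0"
    using iso[of x y] unfolding xy herm_form_scale_left by simp
  then have y0: "\<Phi> *v of_real_vec y = 0"
    using H(2) unfolding positive_definite_herm_def by force
  then have "y = 0" using real_translate_ker[OF det, of X y] by (simp add: \<Phi>_def)
  moreover have "x = 0"
    using xy y0 real_translate_ker[OF det, of X x] by (simp add: \<Phi>_def)
  ultimately show ?thesis using split by (simp add: of_real_vec_def vec_eq_iff)
qed

section \<open>Isogenies with the power of an elliptic curve\<close>

abbreviation of_rat_mat :: "rat^'n^'m \<Rightarrow> complex^'n^'m" where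
  "of_rat_mat \<equiv> map_matrix of_rat"

lemma of_rat_mat_add: "of_rat_mat (A + B) = of_rat_mat A + of_rat_mat B"
  and of_rat_mat_diff: "of_rat_mat (A - B) = of_rat_mat A - of_rat_mat B"
  and of_rat_mat_mult: "of_rat_mat (C ** E) = of_rat_mat C ** of_rat_mat E"
  and of_rat_mat_mat: "of_rat_mat (mat c) = mat (of_rat c)"
  by (simp_all add: vec_eq_iff map_matrix_def of_rat_add of_rat_diff matrix_matrix_mult_def
      of_rat_sum of_rat_mult mat_def)

lemma mat_mult_vec: "mat c *v v = c *s (v :: 'a::semiring_1^'n)"
proof -
  have "(\<Sum>j\<in>UNIV. (if i = j then c else 0) * v $ j) = (\<Sum>j\<in>UNIV. if i = j then c * v $ j else 0)" for i
    by (intro sum.cong) auto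
  then show ?thesis by (simp add: vec_eq_iff matrix_vector_mult_def mat_def)
qed

lemmas of_rat_mat_apply = of_rat_mat_add of_rat_mat_diff of_rat_mat_mult of_rat_mat_mat
  matrix_vector_mul_assoc[symmetric] matrix_vector_mult_add_rdistrib matrix_vector_mult_diff_rdistrib
  matrix_vector_right_distrib matrix_vector_mult_diff_distrib mat_mult_vec vec.scale

lemma det_of_real_mat: "det (of_real_mat A) = of_real (det A)"
  by (simp add: det_def of_real_mat_def)

lemma det_of_rat_mat: "det (map_matrix of_rat A :: ('a::field_char_0)^'n^'n) = of_rat (det A)"
  by (simp add: det_def map_matrix_def of_rat_sum of_rat_mult of_rat_prod)

lemma invertible_iff_ker: "invertible (A :: 'a::field^'n^'n) \<longleftrightarrow> (\<forall>v. A *v v = 0 \<longrightarrow> v = 0)"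
  by (simp add: invertible_left_inverse matrix_left_invertible_ker)

lemma common_denominator:
  assumes "finite (X :: rat set)"
  shows "\<exists>N::nat. N > 0 \<and> (\<forall>x\<in>X. of_nat N * x \<in> \<int>)"
  using assms
proof induction
  case empty
  show ?case by (intro exI[of _ 1]) simp
next
  case (insert x X)
  then obtain N :: nat where N: "N > 0" "\<forall>x\<in>X. of_nat N * x \<in> \<int>" by blast
  obtain a b where ab: "x = of_int a / of_int b" "b > 0"
    by (metis Fract_of_int_quotient Rat_cases)
  have "of_nat (N * nat b) * y \<in> \<int>" if "y \<in> insert x X" for y
  proof (cases "y = x")
    case True
    then have "of_nat (N * nat b) * y = of_int (int N * a)" using ab by simp
    then show ?thesis by (metis Ints_of_int)
  next
    case False
    then have "of_nat N * y \<in> \<int>" using that N by blast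
    then have "of_nat (nat b) * (of_nat N * y) \<in> \<int>" by (rule Ints_mult[OF Ints_of_nat])
    also have "of_nat (nat b) * (of_nat N * y) = of_nat (N * nat b) * y"
      unfolding of_nat_mult by (simp only: mult_ac)
    finally show ?thesis .
  qed
  moreover have "N * nat b > 0" using N ab by simp
  ultimately show ?case by blast
qed

definition of_int_vec :: "int^'n \<Rightarrow> complex^'n" where
  "of_int_vec m = (\<chi> i. of_int (m$i))"

lemma period_lattice_altdef:
  "period_lattice \<tau> = {\<tau> *v of_int_vec m + of_int_vec k | m k. True}"
  unfolding period_lattice_def of_int_vec_def ..

lemma power_lattice_altdef:
  "power_lattice t = {of_int_vec a + t *s of_int_vec b | a b. True}"
proof (intro set_eqI iffI)
  fix v :: "complex^'n"
  assume "v \<in> power_lattice t"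
  then have "\<forall>i. \<exists>a b. v$i = of_int a + of_int b * t"
    unfolding power_lattice_def ell_lattice_def by auto
  then obtain a b where "\<And>i. v$i = of_int (a i) + of_int (b i) * t" by metis
  then have "v = of_int_vec (\<chi> i. a i) + t *s of_int_vec (\<chi> i. b i)"
    by (simp add: vec_eq_iff of_int_vec_def)
  then show "v \<in> {of_int_vec a + t *s of_int_vec b | a b. True}" by blast
next
  fix v :: "complex^'n"
  assume "v \<in> {of_int_vec a + t *s of_int_vec b | a b. True}"
  then show "v \<in> power_lattice t"
    unfolding power_lattice_def ell_lattice_def of_int_vec_def
    by auto (metis mult.commute)
qed

lemma of_int_vec_add: "of_int_vec (a + b) = of_int_vec a + of_int_vec b"
  by (simp add: of_int_vec_def vec_eq_iff)

lemma clear_denominators: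
  fixes P Q R S :: "rat^'n^'m"
  obtains N :: nat where "N > 0"
    "\<And>C m. C \<in> {P, Q, R, S} \<Longrightarrow> \<exists>k. of_nat N *s (of_rat_mat C *v of_int_vec m) = of_int_vec k"
proof -
  define X where "X = (\<lambda>(C, i, j). C$i$j) ` ({P, Q, R, S} \<times> UNIV)"
  have "finite X" unfolding X_def by (intro finite_imageI finite_cartesian_product) simp_all
  then obtain N :: nat where N: "N > 0" "\<forall>x\<in>X. of_nat N * x \<in> \<int>"
    using common_denominator by blast
  have "\<exists>k. of_nat N *s (of_rat_mat C *v of_int_vec m) = of_int_vec k" if C: "C \<in> {P, Q, R, S}" for C m
  proof -
    have "\<forall>i. \<exists>z. of_nat N * (of_rat_mat C *v of_int_vec m) $ i = of_int z"
    proof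
      fix i
      have "of_rat (of_nat N * C$i$j) \<in> (\<int> :: complex set)" for j
      proof -
        have "C$i$j \<in> X" unfolding X_def using C by (intro image_eqI[of _ _ "(C, i, j)"]) simp_all
        then show ?thesis using N(2) by (metis Ints_cases Ints_of_int of_rat_of_int_eq)
      qed
      then have "(\<Sum>j\<in>UNIV. of_rat (of_nat N * C$i$j) * of_int (m$j)) \<in> (\<int> :: complex set)"
        by (intro Ints_sum Ints_mult) simp_all
      also have "(\<Sum>j\<in>UNIV. of_rat (of_nat N * C$i$j) * of_int (m$j)) =
          of_nat N * (of_rat_mat C *v of_int_vec m) $ i"
        by (simp add: matrix_vector_mult_def map_matrix_def of_int_vec_def sum_distrib_left of_rat_mult mult.assoc)
      finally show "\<exists>z. of_nat N * (of_rat_mat C *v of_int_vec m) $ i = of_int z"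
        by (metis Ints_cases)
    qed
    then obtain k where "\<forall>i. of_nat N * (of_rat_mat C *v of_int_vec m) $ i = of_int (k i)" by metis
    then have "of_nat N *s (of_rat_mat C *v of_int_vec m) = of_int_vec (\<chi> i. k i)"
      by (simp add: vec_eq_iff of_int_vec_def)
    then show ?thesis ..
  qed
  with N(1) show thesis by (rule that)
qed

lemma invertible_mat_mult:
  assumes "invertible (A :: complex^'n^'n)" "c \<noteq> 0"
  shows "invertible (mat c ** A)"
  using assms unfolding invertible_iff_ker
  unfolding matrix_vector_mul_assoc[symmetric] mat_mult_vec by (simp add: vec_eq_iff)

lemma isogenous_period_power_latticeI:
  fixes P Q R S :: "rat^'n^'n"
  assumes "invertible A"
    and \<tau>: "\<And>m. A *v (\<tau> *v m) = of_rat_mat R *v m + t *s (of_rat_mat S *v m)"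
    and 1: "\<And>k. A *v k = of_rat_mat P *v k + t *s (of_rat_mat Q *v k)"
  shows "isogenous (period_lattice \<tau>) (power_lattice t)"
proof -
  obtain N :: nat where N: "N > 0" "\<And>C m. C \<in> {P, Q, R, S} \<Longrightarrow>
    \<exists>k. of_nat N *s (of_rat_mat C *v of_int_vec m) = of_int_vec k"
    by (fact clear_denominators[of P Q R S])
  have "(mat (of_nat N) ** A) *v v \<in> power_lattice t" if v_in: "v \<in> period_lattice \<tau>" for v
  proof -
    obtain m k where v: "v = \<tau> *v of_int_vec m + of_int_vec k"
      using v_in unfolding period_lattice_altdef by blast
    obtain a where a: "of_nat N *s (of_rat_mat R *v of_int_vec m) = of_int_vec a" using N(2)[of R] by blast
    obtain b where b: "of_nat N *s (of_rat_mat S *v of_int_vec m) = of_int_vec b" using N(2)[of S] by blast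
    obtain c where c: "of_nat N *s (of_rat_mat P *v of_int_vec k) = of_int_vec c" using N(2)[of P] by blast
    obtain d where d: "of_nat N *s (of_rat_mat Q *v of_int_vec k) = of_int_vec d" using N(2)[of Q] by blast
    have "(mat (of_nat N) ** A) *v v = of_nat N *s (A *v (\<tau> *v of_int_vec m) + A *v of_int_vec k)"
      unfolding v matrix_vector_mul_assoc[symmetric] matrix_vector_right_distrib mat_mult_vec vec.scale
      by (simp add: vec_eq_iff distrib_left mult.left_commute)
    also have "\<dots> = of_int_vec (a + c) + t *s of_int_vec (b + d)"
      unfolding of_int_vec_add a[symmetric] b[symmetric] c[symmetric] d[symmetric] \<tau> 1[of "of_int_vec k"]
      by (simp add: vec_eq_iff distrib_left mult_ac)
    finally have "(mat (of_nat N) ** A) *v v = of_int_vec (a + c) + t *s of_int_vec (b + d)" .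
    then show ?thesis unfolding power_lattice_altdef by blast
  qed
  moreover have "invertible (mat (of_nat N) ** A)" using assms(1) N(1) by (intro invertible_mat_mult) auto
  ultimately show ?thesis unfolding isogenous_def by blast
qed

lemma isogenous_power_period_latticeI:
  fixes X Y Z W :: "rat^'n^'n"
  assumes "invertible B"
    and 1: "\<And>a. B *v a = of_rat_mat X *v a + \<tau> *v (of_rat_mat Y *v a)"
    and t: "\<And>b. t *s (B *v b) = of_rat_mat Z *v b + \<tau> *v (of_rat_mat W *v b)"
  shows "isogenous (power_lattice t) (period_lattice \<tau>)"
proof -
  obtain N :: nat where N: "N > 0" "\<And>C m. C \<in> {X, Y, Z, W} \<Longrightarrow>
    \<exists>k. of_nat N *s (of_rat_mat C *v of_int_vec m) = of_int_vec k"
    by (fact clear_denominators[of X Y Z W])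
  have "(mat (of_nat N) ** B) *v v \<in> period_lattice \<tau>" if v_in: "v \<in> power_lattice t" for v
  proof -
    obtain m k where v: "v = of_int_vec m + t *s of_int_vec k"
      using v_in unfolding power_lattice_altdef by blast
    obtain a where a: "of_nat N *s (of_rat_mat X *v of_int_vec m) = of_int_vec a" using N(2)[of X] by blast
    obtain b where b: "of_nat N *s (of_rat_mat Y *v of_int_vec m) = of_int_vec b" using N(2)[of Y] by blast
    obtain c where c: "of_nat N *s (of_rat_mat Z *v of_int_vec k) = of_int_vec c" using N(2)[of Z] by blast
    obtain d where d: "of_nat N *s (of_rat_mat W *v of_int_vec k) = of_int_vec d" using N(2)[of W] by blast
    have "(mat (of_nat N) ** B) *v v = of_nat N *s (B *v of_int_vec m + t *s (B *v of_int_vec k))"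
      unfolding v matrix_vector_mul_assoc[symmetric] matrix_vector_right_distrib mat_mult_vec vec.scale
      by (simp add: vec_eq_iff distrib_left mult.left_commute)
    also have "\<dots> = \<tau> *v of_int_vec (b + d) + of_int_vec (a + c)"
      unfolding of_int_vec_add a[symmetric] b[symmetric] c[symmetric] d[symmetric] t 1[of "of_int_vec m"]
        matrix_vector_right_distrib vec.scale
      by (simp add: vec_eq_iff distrib_left mult_ac)
    finally show ?thesis unfolding period_lattice_altdef by blast
  qed
  moreover have "invertible (mat (of_nat N) ** B)" using assms(1) N(1) by (intro invertible_mat_mult) auto
  ultimately show ?thesis unfolding isogenous_def by blast
qed

locale cubic_period_matrix = trace_zero_cubic +
  fixes T\<^sub>0 T\<^sub>1 T\<^sub>2 :: "rat^'n^'n" and \<tau> :: "complex^'n^'n"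
  assumes tau: "\<tau>$i$j = of_rat (T\<^sub>0$i$j) + of_rat (T\<^sub>1$i$j) * \<alpha> + of_rat (T\<^sub>2$i$j) * \<alpha>\<^sup>2"
    and det_Im: "det (Im_mat \<tau>) \<noteq> 0"
    and abelian: "is_abelian_variety (period_lattice \<tau>)"
begin

lemma tau_apply: "\<tau> *v m = of_rat_mat T\<^sub>0 *v m + \<alpha> *s (of_rat_mat T\<^sub>1 *v m) + \<alpha>\<^sup>2 *s (of_rat_mat T\<^sub>2 *v m)"
  by (simp add: vec_eq_iff matrix_vector_mult_def map_matrix_def tau sum.distrib algebra_simps sum_distrib_left)

lemma pencil_ker_cnj:
  assumes "of_rat_mat T\<^sub>1 *v m = cnj \<alpha> *s (of_rat_mat T\<^sub>2 *v m)"
  shows "m = 0"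
proof -
  obtain H where H: "H \<in> NS (period_lattice \<tau>)" "positive_definite_herm H"
    using abelian unfolding is_abelian_variety_def by blast
  define X :: "real^'n^'n" where
    "X = (\<chi> i j. of_rat (T\<^sub>0$i$j) + of_rat (T\<^sub>1$i$j) * \<beta> + of_rat (T\<^sub>2$i$j) * \<beta>\<^sup>2)"
  have X: "conj_rel (\<tau>$i$j) (of_real (X$i$j))" for i j
    using conj_relI[of "T\<^sub>0$i$j" "T\<^sub>1$i$j" "T\<^sub>2$i$j"] by (simp add: tau X_def complex_of_rat_eq)
  have "of_real_mat X *v m = of_rat_mat T\<^sub>0 *v m + of_real \<beta> *s (of_rat_mat T\<^sub>1 *v m) + (of_real \<beta>)\<^sup>2 *s (of_rat_mat T\<^sub>2 *v m)"
    by (simp add: vec_eq_iff matrix_vector_mult_def map_matrix_def of_real_mat_def X_def complex_of_rat_eq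
        sum.distrib algebra_simps sum_distrib_left)
  then have "(\<tau> - of_real_mat X) *v m = 0"
    unfolding matrix_vector_mult_diff_rdistrib tau_apply assms of_real_beta
    by (simp add: vec_eq_iff algebra_simps power2_eq_square)
  then show ?thesis by (rule conj_translate_ker[OF H det_Im X])
qed

lemma pencil_ker_alpha:
  assumes "of_rat_mat T\<^sub>1 *v m = \<alpha> *s (of_rat_mat T\<^sub>2 *v m)"
  shows "m = 0"
proof -
  have cnj: "of_rat_mat T *v cnj_vec m = cnj_vec (of_rat_mat T *v m)" for T :: "rat^'n^'n"
    by (simp add: vec_eq_iff cnj_vec_def matrix_vector_mult_def map_matrix_def)
  have "cnj_vec m = 0"
    by (rule pencil_ker_cnj, unfold cnj assms) (simp add: cnj_vec_def vec_eq_iff)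
  then show ?thesis by (simp add: cnj_vec_def vec_eq_iff)
qed

definition real_pencil :: "real \<Rightarrow> real^'n^'n" where
  "real_pencil x = (\<chi> i j. of_rat (T\<^sub>1$i$j) - x * of_rat (T\<^sub>2$i$j))"

lemma det_real_pencil_beta: "det (real_pencil \<beta>) \<noteq> 0"
proof -
  have "Im_mat \<tau> = Im \<alpha> *\<^sub>R real_pencil \<beta>"
    by (simp add: vec_eq_iff Im_mat_def real_pencil_def tau \<beta>_def power2_eq_square algebra_simps)
  then have "Im_mat \<tau> *v x = Im \<alpha> *\<^sub>R (real_pencil \<beta> *v x)" for x
    by (simp add: scaleR_matrix_vector_assoc)
  then have "real_pencil \<beta> *v x = 0 \<Longrightarrow> x = 0" for x
    using Im_mat_ker[OF det_Im] by simp
  then show ?thesis unfolding invertible_det_nz[symmetric] invertible_iff_ker by blast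
qed

lemma pencil_ker_beta:
  assumes "of_rat_mat T\<^sub>1 *v m = of_real \<beta> *s (of_rat_mat T\<^sub>2 *v m)"
  shows "m = 0"
proof -
  have "det (of_real_mat (real_pencil \<beta>)) \<noteq> 0"
    using det_real_pencil_beta by (simp add: det_of_real_mat)
  moreover have "of_real_mat (real_pencil \<beta>) *v m = of_rat_mat T\<^sub>1 *v m - of_real \<beta> *s (of_rat_mat T\<^sub>2 *v m)"
    by (simp add: vec_eq_iff matrix_vector_mult_def map_matrix_def of_real_mat_def real_pencil_def complex_of_rat_eq
        sum_subtractf algebra_simps sum_distrib_left)
  ultimately show ?thesis
    using assms unfolding invertible_det_nz[symmetric] invertible_iff_ker by simp
qed

lemma rational_pencil_invertible: "\<exists>r. invertible (T\<^sub>1 - mat r ** T\<^sub>2)"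
proof -
  have "continuous_on UNIV (\<lambda>x. det (real_pencil x))"
    unfolding det_def real_pencil_def by (auto intro!: continuous_intros)
  then have "open {x. det (real_pencil x) \<noteq> 0}"
    by (rule open_Collect_neq) (rule continuous_on_const)
  then obtain e where e: "e > 0" "ball \<beta> e \<subseteq> {x. det (real_pencil x) \<noteq> 0}"
    using det_real_pencil_beta unfolding open_contains_ball by blast
  obtain r where r: "\<beta> < of_rat r" "of_rat r < \<beta> + e"
    using of_rat_dense[of \<beta> "\<beta> + e"] e(1) by auto
  have "det (real_pencil (of_rat r)) \<noteq> 0"
    using e(2) r by (auto simp: dist_real_def subset_iff)
  moreover have "real_pencil (of_rat r) = map_matrix of_rat (T\<^sub>1 - mat r ** T\<^sub>2)"
    by (simp add: vec_eq_iff real_pencil_def map_matrix_def of_rat_diff of_rat_mult of_rat_sum matrix_matrix_mult_def mat_def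
        if_distrib if_distribR cong: if_cong)
  ultimately have "det (T\<^sub>1 - mat r ** T\<^sub>2) \<noteq> 0" by (simp add: det_of_rat_mat)
  then show ?thesis unfolding invertible_det_nz[symmetric] by blast
qed

text \<open>With \<open>D = T\<^sub>1 - r T\<^sub>2\<close>, \<open>G = D\<^sup>-\<^sup>1 T\<^sub>2\<close> and \<open>M = 1 + r G\<close> the period matrix is
  \<open>T\<^sub>0 + D (\<alpha> M + \<alpha>\<^sup>2 G)\<close>. Since \<open>X\<^sup>3 - p X Y\<^sup>2 - q Y\<^sup>3\<close> splits into the factors \<open>X - \<xi> Y\<close>,
  multiplication by \<open>M - \<alpha> G\<close> makes \<open>\<alpha> M + \<alpha>\<^sup>2 G\<close> affine in \<open>\<alpha>\<close>, and the product of the two other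
  factors, \<open>M\<^sup>2 + \<alpha> M G + (\<alpha>\<^sup>2 - p) G\<^sup>2\<close>, leads back.\<close>
lemma isogenous_elliptic_power:
  "isogenous (period_lattice \<tau>) (power_lattice \<alpha> :: (complex^'n) set)" (is ?thesis1)
  "isogenous (power_lattice \<alpha> :: (complex^'n) set) (period_lattice \<tau>)" (is ?thesis2)
proof -
  obtain r where "invertible (T\<^sub>1 - mat r ** T\<^sub>2)" using rational_pencil_invertible by blast
  then obtain Di where D1: "(T\<^sub>1 - mat r ** T\<^sub>2) ** Di = mat 1" and D2: "Di ** (T\<^sub>1 - mat r ** T\<^sub>2) = mat 1"
    unfolding invertible_def by blast
  define D where "D = T\<^sub>1 - mat r ** T\<^sub>2"
  define G where "G = Di ** T\<^sub>2"
  define M where "M = mat 1 + mat r ** G"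
  define g where "g = of_rat_mat G"
  define d where "d = of_rat_mat D"
  define di where "di = of_rat_mat Di"
  define N where "N x = mat 1 + mat (of_rat r - x) ** g" for x
  have ddi: "d *v (di *v v) = v" "di *v (d *v v) = v" for v
    unfolding d_def di_def D_def matrix_vector_mul_assoc of_rat_mat_mult[symmetric] D1 D2
    by (simp_all add: of_rat_mat_mat)
  have T2: "of_rat_mat T\<^sub>2 *v v = d *v (g *v v)" for v
    using ddi(1)[of "of_rat_mat T\<^sub>2 *v v"]
    by (simp add: g_def G_def di_def of_rat_mat_mult matrix_vector_mul_assoc)
  have T1: "of_rat_mat T\<^sub>1 *v v = d *v v + of_rat r *s (d *v (g *v v))" for v
    unfolding T2[symmetric] by (simp add: d_def D_def of_rat_mat_apply)
  have N_apply: "N x *v v = v + (of_rat r - x) *s (g *v v)" for x v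
    by (simp add: N_def of_rat_mat_apply)
  have g_add: "g *v (u + v) = g *v u + g *v v"
    and g_scale: "g *v (c *s v) = c *s (g *v v)" for u v c
    by (simp_all add: of_rat_mat_apply)
  have N_inv: "invertible (N x)"
    if ker: "\<And>m. of_rat_mat T\<^sub>1 *v m = x *s (of_rat_mat T\<^sub>2 *v m) \<Longrightarrow> m = 0" for x
    unfolding invertible_iff_ker
  proof (intro allI impI)
    fix v assume "N x *v v = 0"
    then have "v = (x - of_rat r) *s (g *v v)" by (simp add: N_apply vec_eq_iff algebra_simps)
    then have "d *v v = (x - of_rat r) *s (d *v (g *v v))" by (metis vec.scale)
    then have "of_rat_mat T\<^sub>1 *v v = x *s (of_rat_mat T\<^sub>2 *v v)"
      unfolding T1 T2 by (simp add: vec_eq_iff algebra_simps)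
    then show "v = 0" by (rule ker)
  qed
  have d_inv: "invertible d" "invertible di"
    unfolding invertible_iff_ker using ddi by (metis matrix_vector_mult_0_right)+
  have di_T2: "di *v (of_rat_mat T\<^sub>2 *v m) = g *v m" for m by (simp add: T2 ddi)
  have di_T1: "di *v (of_rat_mat T\<^sub>1 *v m) = m + of_rat r *s (g *v m)" for m
    by (simp add: T1 ddi matrix_vector_right_distrib vec.scale)
  show ?thesis1
  proof (rule isogenous_period_power_latticeI)
    show "invertible (N \<alpha> ** di)"
      by (intro invertible_mult d_inv N_inv pencil_ker_alpha)
    show "(N \<alpha> ** di) *v k = of_rat_mat (M ** Di) *v k + \<alpha> *s (of_rat_mat (mat (-1) ** G ** Di) *v k)" for k
      by (simp add: of_rat_mat_apply N_apply M_def g_def di_def vec_eq_iff of_rat_minus algebra_simps)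
    show "(N \<alpha> ** di) *v (\<tau> *v m) = of_rat_mat (M ** Di ** T\<^sub>0 - mat q ** G ** G) *v m
      + \<alpha> *s (of_rat_mat (mat (-1) ** G ** Di ** T\<^sub>0 + M ** M - mat p ** G ** G) *v m)" for m
      unfolding tau_apply matrix_vector_right_distrib vec.scale matrix_vector_mul_assoc[symmetric] di_T1 di_T2
      unfolding of_rat_mat_apply M_def N_apply g_def[symmetric] di_def[symmetric] vec_eq_iff
      apply (simp add: of_rat_minus)
      using cube by algebra
  qed
  have NN: "N (cnj \<alpha>) *v (N (of_real \<beta>) *v v) =
    v + (2 * of_rat r + \<alpha>) *s (g *v v) + ((of_rat r)\<^sup>2 + of_rat r * \<alpha> + \<alpha>\<^sup>2 - of_rat p) *s (g *v (g *v v))" for v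
    unfolding N_apply g_add g_scale of_real_beta root_sum[symmetric]
    by (simp add: vec_eq_iff algebra_simps power2_eq_square)
  show ?thesis2
  proof (rule isogenous_power_period_latticeI)
    show "invertible (d ** (N (cnj \<alpha>) ** N (of_real \<beta>)))"
      by (intro invertible_mult d_inv N_inv) (auto intro: pencil_ker_cnj pencil_ker_beta)
    show "(d ** (N (cnj \<alpha>) ** N (of_real \<beta>))) *v a =
      of_rat_mat (D ** M ** M - mat p ** D ** G ** G - T\<^sub>0 ** G) *v a + \<tau> *v (of_rat_mat G *v a)" for a
      unfolding tau_apply T1 T2 unfolding matrix_vector_mul_assoc[symmetric] NN
      unfolding of_rat_mat_apply M_def N_apply g_def[symmetric] d_def[symmetric] vec_eq_iff
      by (simp add: algebra_simps power2_eq_square)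
    show "\<alpha> *s ((d ** (N (cnj \<alpha>) ** N (of_real \<beta>))) *v b) =
      of_rat_mat (mat q ** D ** G ** G - T\<^sub>0 ** M) *v b + \<tau> *v (of_rat_mat M *v b)" for b
      unfolding tau_apply T1 T2 unfolding matrix_vector_mul_assoc[symmetric] NN
      unfolding of_rat_mat_apply M_def N_apply g_def[symmetric] d_def[symmetric] vec_eq_iff
      apply simp
      using cube by algebra
  qed
qed

end

section \<open>Complex multiplication and the Picard number\<close>

lemma (in trace_zero_cubic) End_Q_real:
  assumes "z \<in> End_Q \<alpha>"
  shows "Im z = 0"
proof -
  obtain n :: nat where n: "n > 0" "\<And>w. w \<in> ell_lattice \<alpha> \<Longrightarrow> of_nat n * z * w \<in> ell_lattice \<alpha>"
    using assms unfolding End_Q_def by blast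
  have "1 \<in> ell_lattice \<alpha>" "\<alpha> \<in> ell_lattice \<alpha>"
    unfolding ell_lattice_def
    by (auto intro: exI[of _ "1::int"] exI[of _ "0::int"])
  from this[THEN n(2)] obtain a b c d
    where ab: "of_nat n * z = of_int a + of_int b * \<alpha>"
      and cd: "of_nat n * z * \<alpha> = of_int c + of_int d * \<alpha>"
    unfolding ell_lattice_def by auto
  have "of_rat (of_int (- c)) + of_rat (of_int (a - d)) * \<alpha> + of_rat (of_int b) * \<alpha>\<^sup>2 = 0"
    using cd unfolding ab by (simp add: algebra_simps power2_eq_square of_rat_minus of_rat_diff)
  from indep[OF this] have "b = 0" by simp
  then have "Im (of_nat n * z) = 0" unfolding ab by simp
  then show ?thesis using n(1) by simp
qed

lemma (in trace_zero_cubic) not_has_CM: "\<not> has_CM \<alpha>"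
proof
  assume "has_CM \<alpha>"
  then obtain d :: int where d: "d < 0" and E: "End_Q \<alpha> = {of_rat a + of_rat b * csqrt (of_int d) | a b. True}"
    unfolding has_CM_def imag_quadratic_field_def by blast
  define s where "s = csqrt (of_int d)"
  have "of_rat 0 + of_rat 1 * s \<in> End_Q \<alpha>" unfolding E s_def by blast
  then have "Im s = 0" by (simp add: End_Q_real)
  moreover have "Re (s\<^sup>2) < 0" using d unfolding s_def power2_csqrt by simp
  ultimately show False by (simp add: power2_eq_square not_less)
qed

definition pullback :: "complex^'n^'n \<Rightarrow> complex^'n^'n \<Rightarrow> complex^'n^'n" where
  "pullback A H = (\<chi> i j. herm_form H (column i A) (column j A))"

lemma herm_form_pullback: "herm_form (pullback A H) v w = herm_form H (A *v v) (A *v w)"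
proof -
  have "herm_form H (A *v v) (A *v w) = (\<Sum>i\<in>UNIV. v$i * herm_form H (column i A) (A *v w))"
    by (simp only: matrix_mult_sum[of A v] herm_form_sum_left herm_form_scale_left)
  also have "\<dots> = (\<Sum>i\<in>UNIV. v$i * (\<Sum>j\<in>UNIV. cnj (w$j) * herm_form H (column i A) (column j A)))"
    by (simp only: matrix_mult_sum[of A w] herm_form_sum_right herm_form_scale_right)
  also have "\<dots> = herm_form (pullback A H) v w"
    unfolding herm_form_def[of "pullback A H"] by (simp add: pullback_def mult_ac sum_distrib_left)
  finally show ?thesis by simp
qed

lemma herm_form_axis: "herm_form H (axis i 1) (axis j 1) = H$i$j"
proof -
  have "(\<Sum>l\<in>UNIV. axis i 1 $ k * H$k$l * cnj (axis j 1 $ l)) = (if k = i then H$k$j else 0)" for k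
  proof -
    have "(\<Sum>l\<in>UNIV. axis i 1 $ k * H$k$l * cnj (axis j 1 $ l)) =
      (\<Sum>l\<in>UNIV. if l = j then (if k = i then H$k$l else 0) else 0)"
      by (intro sum.cong) (auto simp: axis_def)
    then show ?thesis by simp
  qed
  then show ?thesis by (simp add: herm_form_def)
qed

lemma herm_form_sum_scaleR:
  "herm_form (\<Sum>H\<in>S. c H *\<^sub>R f H) v w = (\<Sum>H\<in>S. of_real (c H) * herm_form (f H) v w)"
proof (induction S rule: infinite_finite_induct)
  case (insert x F)
  then show ?case
    by (simp add: herm_form_def algebra_simps sum.distrib sum_distrib_left scaleR_conv_of_real[where 'a = complex])
qed (simp_all add: herm_form_def)

lemma pullback_sum_scaleR: "pullback A (\<Sum>H\<in>S. c H *\<^sub>R H) = (\<Sum>H\<in>S. c H *\<^sub>R pullback A H)"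
  by (simp add: vec_eq_iff herm_form_axis[symmetric] herm_form_pullback herm_form_sum_scaleR
      scaleR_conv_of_real[where 'a = complex] del: axis_nth)

lemma pullback_eq_0:
  assumes "invertible A" "pullback A H = 0"
  shows "H = 0"
proof -
  obtain B where B: "A ** B = mat 1" using assms(1) unfolding invertible_def by blast
  have "H$i$j = herm_form (pullback A H) (B *v axis i 1) (B *v axis j 1)" for i j
    by (simp add: herm_form_pullback matrix_vector_mul_assoc B herm_form_axis)
  then show ?thesis using assms(2) by (simp add: vec_eq_iff herm_form_def)
qed

lemma pullback_inj:
  assumes "invertible A"
  shows "inj (pullback A)"
proof
  fix H K assume "pullback A H = pullback A K"
  then have "pullback A (H - K) = 0"
    by (simp add: pullback_def vec_eq_iff herm_form_def left_diff_distrib right_diff_distrib sum_subtractf)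
  then show "H = K" using pullback_eq_0[OF assms] by fastforce
qed

lemma pullback_NS:
  assumes "H \<in> NS L2" "\<And>v. v \<in> L1 \<Longrightarrow> A *v v \<in> L2"
  shows "pullback A H \<in> NS L1"
proof -
  have "hermitian_mat (pullback A H)"
    using assms(1) herm_form_swap unfolding NS_def hermitian_mat_def pullback_def by auto
  then show ?thesis using assms unfolding NS_def by (simp add: herm_form_pullback)
qed

lemma isogenous_NS_independent:
  assumes "isogenous L1 L2" and S: "S \<subseteq> NS L2" "finite S" "int_independent S"
  shows "\<exists>S'. S' \<subseteq> NS L1 \<and> finite S' \<and> card S' = card S \<and> int_independent S'"
proof -
  obtain A where A: "invertible A" "\<And>v. v \<in> L1 \<Longrightarrow> A *v v \<in> L2"
    using assms(1) unfolding isogenous_def by blast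
  have inj: "inj_on (pullback A) S" using pullback_inj[OF A(1)] by (rule inj_on_subset) simp
  have "int_independent (pullback A ` S)"
    unfolding int_independent_def
  proof (intro allI impI)
    fix c :: "complex^'a^'a \<Rightarrow> int"
    assume "(\<Sum>H\<in>pullback A ` S. real_of_int (c H) *\<^sub>R H) = 0"
    then have "pullback A (\<Sum>H\<in>S. real_of_int (c (pullback A H)) *\<^sub>R H) = 0"
      by (simp add: sum.reindex[OF inj] pullback_sum_scaleR)
    then have "(\<Sum>H\<in>S. real_of_int (c (pullback A H)) *\<^sub>R H) = 0"
      by (rule pullback_eq_0[OF A(1)])
    then have "\<forall>H\<in>S. c (pullback A H) = 0"
      using S(3)[unfolded int_independent_def, rule_format, of "\<lambda>H. c (pullback A H)"] by blast
    then show "\<forall>H\<in>pullback A ` S. c H = 0" by blast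
  qed
  moreover have "pullback A ` S \<subseteq> NS L1" using S(1) pullback_NS A(2) by blast
  ultimately show ?thesis using S(2) card_image[OF inj] by blast
qed

context trace_zero_cubic
begin

definition scaled_int_mat :: "('n \<Rightarrow> 'n \<Rightarrow> int) \<Rightarrow> complex^'n^'n" where
  "scaled_int_mat M = (\<chi> i j. of_int (M i j) / of_real (Im \<alpha>))"

lemma NS_power_latticeD:
  assumes H: "H \<in> NS (power_lattice \<alpha> :: (complex^'n) set)"
  shows "\<exists>M. (\<forall>i j. M i j = M j i) \<and> H = scaled_int_mat M"
proof -
  have herm: "hermitian_mat H" and
    int: "\<And>v w. v \<in> power_lattice \<alpha> \<Longrightarrow> w \<in> power_lattice \<alpha> \<Longrightarrow> Im (herm_form H v w) \<in> \<int>"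
    using H unfolding NS_def by auto
  have lat: "axis i 1 \<in> power_lattice \<alpha>" "\<alpha> *s axis i 1 \<in> power_lattice \<alpha>" for i :: 'n
  proof -
    have "0 \<in> ell_lattice \<alpha>" "1 \<in> ell_lattice \<alpha>" "\<alpha> \<in> ell_lattice \<alpha>"
      unfolding ell_lattice_def by (auto intro: exI[of _ "1::int"] exI[of _ "0::int"])
    then show "axis i 1 \<in> power_lattice \<alpha>" "\<alpha> *s axis i 1 \<in> power_lattice \<alpha>"
      unfolding power_lattice_def by (auto simp: axis_def)
  qed
  have "\<exists>m::int. H$i$j = of_int m / of_real (Im \<alpha>)" for i j
  proof -
    have "Im (H$i$j) \<in> \<int>" using int[OF lat(1) lat(1), of i j] by (simp add: herm_form_axis)
    then obtain k where k: "Im (H$i$j) = of_int k" by (rule Ints_cases)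
    have "Im (\<alpha> * H$i$j) \<in> \<int>"
      using int[OF lat(2) lat(1), of i j] by (simp add: herm_form_axis herm_form_scale_left)
    then obtain l where l: "Im (\<alpha> * H$i$j) = of_int l" by (rule Ints_cases)
    have "Im (cnj \<alpha> * H$i$j) \<in> \<int>"
      using int[OF lat(1) lat(2), of i j] by (simp add: herm_form_axis herm_form_scale_right)
    then obtain m where m: "Im (cnj \<alpha> * H$i$j) = of_int m" by (rule Ints_cases)
    have "\<beta> * of_int k = - of_int (l + m)"
      using l m k by (simp add: \<beta>_def algebra_simps)
    then have "k = 0"
      using beta_not_rat[of "of_int (- (l + m)) / of_int k"]
      unfolding of_rat_divide of_rat_of_int_eq by (auto simp: eq_divide_eq split: if_splits)
    then have "Im \<alpha> * Re (H$i$j) = of_int l" using k l by simp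
    then have "H$i$j = of_int l / of_real (Im \<alpha>)"
      using Im_pos k \<open>k = 0\<close> by (simp add: complex_eq_iff field_simps)
    then show ?thesis ..
  qed
  then obtain M where M: "\<And>i j. H$i$j = of_int (M i j) / of_real (Im \<alpha>)" by metis
  have "M i j = M j i" for i j
  proof -
    have "H$j$i = cnj (H$i$j)" using herm unfolding hermitian_mat_def by blast
    then show ?thesis using Im_pos by (simp add: M)
  qed
  then show ?thesis using M by (auto simp: scaled_int_mat_def vec_eq_iff)
qed

lemma NS_power_latticeI:
  assumes M: "\<And>i j. M i j = M j i"
  shows "scaled_int_mat M \<in> NS (power_lattice \<alpha>)"
proof -
  have "hermitian_mat (scaled_int_mat M)"
    using M unfolding hermitian_mat_def scaled_int_mat_def by simp
  moreover have "Im (herm_form (scaled_int_mat M) v w) \<in> \<int>"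
    if v: "v \<in> power_lattice \<alpha>" and w: "w \<in> power_lattice \<alpha>" for v w
  proof -
    have "Im (v$i * scaled_int_mat M $i$j * cnj (w$j)) \<in> \<int>" for i j
    proof -
      obtain a b where ab: "v$i = of_int a + of_int b * \<alpha>" using v unfolding power_lattice_def ell_lattice_def by blast
      obtain c d where cd: "w$j = of_int c + of_int d * \<alpha>" using w unfolding power_lattice_def ell_lattice_def by blast
      have "v$i * scaled_int_mat M $i$j * cnj (w$j) = of_real (of_int (M i j) / Im \<alpha>) * (v$i * cnj (w$j))"
        by (simp add: scaled_int_mat_def)
      then have "Im (v$i * scaled_int_mat M $i$j * cnj (w$j)) = of_int (M i j) / Im \<alpha> * Im (v$i * cnj (w$j))"
        by (simp only: Im_complex_of_real Re_complex_of_real times_complex.sel)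
      also have "Im (v$i * cnj (w$j)) = of_int (b * c - a * d) * Im \<alpha>"
        unfolding ab cd by (simp add: algebra_simps)
      also have "of_int (M i j) / Im \<alpha> * (of_int (b * c - a * d) * Im \<alpha>) = of_int (M i j * (b * c - a * d))"
        using Im_pos by simp
      finally show ?thesis by (metis Ints_of_int)
    qed
    then show ?thesis unfolding herm_form_def Im_sum by (intro Ints_sum)
  qed
  ultimately show ?thesis unfolding NS_def by blast
qed

end

lemma card_index_pairs:
  fixes f :: "'n::finite \<Rightarrow> nat"
  assumes "inj f"
  shows "card {(i, j). f i \<le> f j} = CARD('n) * (CARD('n) + 1) div 2"
proof -
  define P Q where "P = {(i, j). f i \<le> f j}" and "Q = {(i, j). f j \<le> f i}"
  have "Q = prod.swap ` P" unfolding P_def Q_def by force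
  then have "card Q = card P" by (simp add: card_image)
  moreover have "P \<union> Q = UNIV" unfolding P_def Q_def by auto
  moreover have "P \<inter> Q = (\<lambda>i. (i, i)) ` UNIV"
    unfolding P_def Q_def by (auto simp: image_iff inj_eq[OF assms])
  moreover have "card ((\<lambda>i::'n. (i, i)) ` UNIV) = CARD('n)"
    by (intro card_image) (simp add: inj_on_def)
  moreover have "CARD('n \<times> 'n) = CARD('n) * CARD('n)" by simp
  ultimately have "2 * card P = CARD('n) * CARD('n) + CARD('n)"
    using card_Un_Int[of P Q] by simp
  then show ?thesis unfolding P_def by simp
qed

context trace_zero_cubic
begin

lemma NS_power_lattice_upper:
  assumes S: "S \<subseteq> NS (power_lattice \<alpha> :: (complex^'n) set)" "finite S" "int_independent S"
  shows "card S \<le> CARD('n) * (CARD('n) + 1) div 2"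
proof (rule ccontr)
  assume less: "\<not> ?thesis"
  obtain f :: "'n \<Rightarrow> nat" where f: "inj f"
    using ex_bij_betw_finite_nat[of "UNIV :: 'n set"] bij_betw_imp_inj_on by blast
  have "\<forall>H\<in>S. \<exists>M. (\<forall>i j. M i j = M j i) \<and> H = scaled_int_mat M"
    using S(1) NS_power_latticeD by blast
  then obtain M where M: "\<And>H i j. H \<in> S \<Longrightarrow> M H i j = M H j i" "\<And>H. H \<in> S \<Longrightarrow> H = scaled_int_mat (M H)"
    by metis
  have "card {(i, j). f i \<le> f j} < card S" using less by (simp add: card_index_pairs[OF f])
  from linear_dependence[OF _ S(2) this, of "\<lambda>H (i, j). M H i j"]
  obtain c where c: "\<exists>H\<in>S. c H \<noteq> 0"
    and c0: "\<And>i j. f i \<le> f j \<Longrightarrow> (\<Sum>H\<in>S. c H * M H i j) = 0" by auto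
  have all: "(\<Sum>H\<in>S. c H * M H i j) = 0" for i j
  proof (cases "f i \<le> f j")
    case False
    have "(\<Sum>H\<in>S. c H * M H i j) = (\<Sum>H\<in>S. c H * M H j i)"
      using M(1) by (intro sum.cong) auto
    then show ?thesis using c0[of j i] False by simp
  qed (rule c0)
  have "(\<Sum>H\<in>S. real_of_int (c H) *\<^sub>R H) = 0"
  proof -
    have "(\<Sum>H\<in>S. real_of_int (c H) *\<^sub>R H) $ i $ j = of_int (\<Sum>H\<in>S. c H * M H i j) / of_real (Im \<alpha>)" for i j
    proof -
      have "H $ i $ j = of_int (M H i j) / of_real (Im \<alpha>)" if "H \<in> S" for H
        using arg_cong[OF M(2)[OF that], of "\<lambda>H. H $ i $ j"] by (simp add: scaled_int_mat_def)
      then show ?thesis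
        by (simp add: sum_component scaleR_conv_of_real[where 'a = complex] sum_divide_distrib)
    qed
    then show ?thesis by (simp add: all vec_eq_iff)
  qed
  then show False using c S(3) unfolding int_independent_def by blast
qed

lemma NS_power_lattice_lower:
  "\<exists>S. S \<subseteq> NS (power_lattice \<alpha> :: (complex^'n) set) \<and> finite S \<and>
    card S = CARD('n) * (CARD('n) + 1) div 2 \<and> int_independent S"
proof -
  obtain f :: "'n \<Rightarrow> nat" where f: "inj f"
    using ex_bij_betw_finite_nat[of "UNIV :: 'n set"] bij_betw_imp_inj_on by blast
  define P where "P = {(i, j). f i \<le> f j}"
  define E :: "'n \<times> 'n \<Rightarrow> complex^'n^'n" where
    "E p = scaled_int_mat (\<lambda>a b. if (a, b) = p \<or> (b, a) = p then 1 else 0)" for p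
  have E_nth: "E p $ fst r $ snd r = (if r = p then 1 / of_real (Im \<alpha>) else 0)"
    if "p \<in> P" "r \<in> P" for p r
    using that injD[OF f] by (cases p; cases r) (auto simp: E_def scaled_int_mat_def P_def)
  have inj: "inj_on E P"
  proof
    fix p r assume pr: "p \<in> P" "r \<in> P" "E p = E r"
    then show "p = r" using E_nth[of p p] E_nth[of r p] Im_pos by (auto split: if_splits)
  qed
  have "int_independent (E ` P)"
    unfolding int_independent_def
  proof (intro allI impI ballI)
    fix c :: "complex^'n^'n \<Rightarrow> int" and H
    assume 0: "(\<Sum>H\<in>E ` P. real_of_int (c H) *\<^sub>R H) = 0" and "H \<in> E ` P"
    then obtain r where r: "r \<in> P" "H = E r" by blast
    have "0 = (\<Sum>p\<in>P. real_of_int (c (E p)) *\<^sub>R E p) $ fst r $ snd r"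
      using 0 by (simp add: sum.reindex[OF inj])
    also have "\<dots> = (\<Sum>p\<in>P. if p = r then of_int (c (E r)) / of_real (Im \<alpha>) else 0)"
      unfolding sum_component using r(1)
      by (intro sum.cong) (auto simp: E_nth scaleR_conv_of_real[where 'a = complex])
    also have "\<dots> = of_int (c (E r)) / of_real (Im \<alpha>)" using r(1) by simp
    finally show "c H = 0" using Im_pos r(2) by simp
  qed
  moreover have "E ` P \<subseteq> NS (power_lattice \<alpha>)"
    unfolding E_def by (auto intro!: NS_power_latticeI)
  ultimately show ?thesis
    using card_image[OF inj] card_index_pairs[OF f] unfolding P_def
    by (intro exI[of _ "E ` {(i, j). f i \<le> f j}"]) (simp add: P_def)
qed

lemma picard_number_isogenous_power:
  fixes L :: "(complex^'n) set"
  assumes "isogenous L (power_lattice \<alpha>)" "isogenous (power_lattice \<alpha>) L"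
  shows "picard_number L = CARD('n) * (CARD('n) + 1) div 2"
  unfolding picard_number_def
proof (rule Greatest_equality)
  obtain S where "S \<subseteq> NS (power_lattice \<alpha> :: (complex^'n) set)" "finite S"
    "card S = CARD('n) * (CARD('n) + 1) div 2" "int_independent S"
    using NS_power_lattice_lower by blast
  then show "\<exists>S. S \<subseteq> NS L \<and> finite S \<and> card S = CARD('n) * (CARD('n) + 1) div 2 \<and> int_independent S"
    using isogenous_NS_independent[OF assms(1)] by metis
next
  fix k assume "\<exists>S. S \<subseteq> NS L \<and> finite S \<and> card S = k \<and> int_independent S"
  then obtain S' where "S' \<subseteq> NS (power_lattice \<alpha> :: (complex^'n) set)" "finite S'" "card S' = k" "int_independent S'"
    using isogenous_NS_independent[OF assms(2)] by metis
  then show "k \<le> CARD('n) * (CARD('n) + 1) div 2" using NS_power_lattice_upper by blast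
qed

end

theorem theorem1p1:
  fixes \<tau> :: "complex^'n^'n"
  assumes "CARD('n) \<ge> 2"
    and "det (Im_mat \<tau>) \<noteq> 0"
    and "is_abelian_variety (period_lattice \<tau>)"
    and "Q_degree_eq (gen_field {\<tau>$i$j | i j. True}) 3"
  shows "(\<exists>t. Im t > 0 \<and> \<not> has_CM t \<and>
            isogenous (period_lattice \<tau>) (power_lattice t :: (complex^'n) set))
         \<and> picard_number (period_lattice \<tau>) = CARD('n) * (CARD('n) + 1) div 2"
proof -
  define K where "K = gen_field {\<tau>$i$j | i j. True}"
  have entries: "\<tau>$i$j \<in> K" for i j
    unfolding K_def by (rule subsetD[OF gen_field_superset]) auto
  have "\<exists>i j. Im (\<tau>$i$j) \<noteq> 0"
  proof (rule ccontr)
    assume "\<not> ?thesis"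
    then have "Im_mat \<tau> *v 1 = 0" by (simp add: Im_mat_def matrix_vector_mult_def vec_eq_iff)
    from Im_mat_ker[OF assms(2) this] show False by simp
  qed
  then obtain i j where "Im (\<tau>$i$j) \<noteq> 0" by blast
  then obtain \<alpha> p q where \<alpha>: "trace_zero_cubic \<alpha> p q"
    and span: "\<And>x. x \<in> K \<Longrightarrow> \<exists>a b c. x = of_rat a + of_rat b * \<alpha> + of_rat c * \<alpha>\<^sup>2"
    using cubic_field_trace_zero_generator[of K "\<tau>$i$j"] is_subfield_gen_field assms(4) entries
    unfolding K_def by metis
  interpret trace_zero_cubic \<alpha> p q by (fact \<alpha>)
  obtain a b c where abc: "\<And>i j. \<tau>$i$j = of_rat (a i j) + of_rat (b i j) * \<alpha> + of_rat (c i j) * \<alpha>\<^sup>2"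
    using span[OF entries] by metis
  interpret cubic_period_matrix \<alpha> p q "\<chi> i j. a i j" "\<chi> i j. b i j" "\<chi> i j. c i j" \<tau>
    by unfold_locales (simp_all add: abc assms(2,3))
  show ?thesis
    using Im_pos not_has_CM isogenous_elliptic_power picard_number_isogenous_power by blast
qed

end
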